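(* Let $G$ be a group and let $V$ be a non-zero vector space over a field $\mathbb{K}$. Suppose that the group $G$ admits an element $g_0$ having infinite order. Then the map $\tau \colon V^G \to V^G$ defined by $\tau(x)(g) = x(gg_0) - x(g)$ for all $x \in V^G$ and $g \in G$ is a linear cellular automaton which is surjective but not injective.
   Context: Let $G$ be a group and $A$ a set. $A^G$ denotes the set of all maps $x \colon G \to A$ (configurations). The group $G$ acts on $A^G$ by $(gx)(h) = x(g^{-1}h)$ for all $x \in A^G$ and $g,h \in G$. A cellular automaton over the group $G$ and the alphabet $A$ is a map $\tau \colon A^G \to A^G$ for which there exist a finite subset $M \subset G$ (a memory set) and a map $\mu \colon A^M \to A$ (a local defining map) such that $\tau(x)(g) = \mu((g^{-1}x)|_M)$ for all $x \in A^G$ and $g \in G$, where $(\cdot)|_M \colon A^G \to A^M$ is the restriction map. If $V$ is a vector space over a field $\mathbb{K}$, a cellular automaton $\tau \colon V^G \to V^G$ is called a linear cellular automaton if $\tau$ is $\mathbb{K}$-linear with respect to the product (pointwise) vector space structure on $V^G$. The vector space $V$ is not assumed to be finite-dimensional. *)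

theory Defs
  imports "HOL-Algebra.Multiplicative_Group" "HOL-Algebra.Module"
begin

text \<open>
  Maps with domain \<open>X\<close> are represented by extensional functions (\<open>X \<rightarrow>\<^sub>E A\<close>), so that
  equality of configurations is equality of their values on the carrier of the group.
\<close>

definition configs :: "('g, 'm) monoid_scheme \<Rightarrow> 'a set \<Rightarrow> ('g \<Rightarrow> 'a) set" where
  "configs G A = (carrier G \<rightarrow>\<^sub>E A)"

definition shift :: "('g, 'm) monoid_scheme \<Rightarrow> 'g \<Rightarrow> ('g \<Rightarrow> 'a) \<Rightarrow> ('g \<Rightarrow> 'a)" where
  "shift G g x = (\<lambda>h\<in>carrier G. x (inv\<^bsub>G\<^esub> g \<otimes>\<^bsub>G\<^esub> h))"

definition cellular_automaton ::
    "('g, 'm) monoid_scheme \<Rightarrow> 'a set \<Rightarrow> (('g \<Rightarrow> 'a) \<Rightarrow> ('g \<Rightarrow> 'a)) \<Rightarrow> bool" where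
  "cellular_automaton G A \<tau> \<longleftrightarrow>
     \<tau> \<in> configs G A \<rightarrow> configs G A \<and>
     (\<exists>M \<mu>. finite M \<and> M \<subseteq> carrier G \<and> \<mu> \<in> (M \<rightarrow>\<^sub>E A) \<rightarrow> A \<and>
        (\<forall>x\<in>configs G A. \<forall>g\<in>carrier G.
           \<tau> x g = \<mu> (restrict (shift G (inv\<^bsub>G\<^esub> g) x) M)))"

text \<open>
  The product module \<open>V\<^sup>G\<close>. The fields \<open>mult\<close> and \<open>one\<close> are present only because the
  record of modules extends that of rings; they play no role.
\<close>

definition config_module ::
    "('g, 'm) monoid_scheme \<Rightarrow> ('k, 'v, 'n) module_scheme \<Rightarrow> ('k, 'g \<Rightarrow> 'v) module" where
  "config_module G V =
     \<lparr>carrier = configs G (carrier V),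
      mult = (\<lambda>x y. \<lambda>g\<in>carrier G. x g \<otimes>\<^bsub>V\<^esub> y g),
      one = (\<lambda>g\<in>carrier G. \<one>\<^bsub>V\<^esub>),
      zero = (\<lambda>g\<in>carrier G. \<zero>\<^bsub>V\<^esub>),
      add = (\<lambda>x y. \<lambda>g\<in>carrier G. x g \<oplus>\<^bsub>V\<^esub> y g),
      smult = (\<lambda>a x. \<lambda>g\<in>carrier G. a \<odot>\<^bsub>V\<^esub> x g)\<rparr>"

lemma module_config_module:
  assumes "module K V"
  shows "module K (config_module G V)"
proof -
  interpret V: module K V by fact
  have cfg: "x g \<in> carrier V" if "x \<in> configs G (carrier V)" "g \<in> carrier G" for x g
    using that by (auto simp: configs_def)
  have eqI: "x = y"
    if "x \<in> configs G (carrier V)" "y \<in> configs G (carrier V)"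
       "\<And>g. g \<in> carrier G \<Longrightarrow> x g = y g" for x y
    using that unfolding configs_def by (rule PiE_ext)
  have resI: "(\<lambda>g\<in>carrier G. f g) \<in> configs G (carrier V)"
    if "\<And>g. g \<in> carrier G \<Longrightarrow> f g \<in> carrier V" for f
    using that by (auto simp: configs_def)
  show ?thesis
  proof (rule moduleI)
    show "cring K" by (rule V.R.is_cring)
    show "abelian_group (config_module G V)"
    proof (rule abelian_groupI)
      fix x assume x: "x \<in> carrier (config_module G V)"
      show "\<exists>y\<in>carrier (config_module G V).
              y \<oplus>\<^bsub>config_module G V\<^esub> x = \<zero>\<^bsub>config_module G V\<^esub>"
        using x by (intro bexI[of _ "\<lambda>g\<in>carrier G. \<ominus>\<^bsub>V\<^esub> x g"])
          (auto simp: config_module_def cfg V.M.l_neg intro!: resI)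
    qed (auto simp: config_module_def cfg V.M.a_ac intro!: resI eqI)
  qed (auto simp: config_module_def cfg V.smult_l_distr V.smult_r_distr V.smult_assoc1
         intro!: resI eqI)
qed

definition linear_maps ::
    "('k, 'l) ring_scheme \<Rightarrow> ('k, 'v, 'm) module_scheme \<Rightarrow> ('k, 'w, 'n) module_scheme
       \<Rightarrow> ('v \<Rightarrow> 'w) set" where
  "linear_maps K V W =
     {f \<in> carrier V \<rightarrow> carrier W.
        (\<forall>x\<in>carrier V. \<forall>y\<in>carrier V. f (x \<oplus>\<^bsub>V\<^esub> y) = f x \<oplus>\<^bsub>W\<^esub> f y) \<and>
        (\<forall>a\<in>carrier K. \<forall>x\<in>carrier V. f (a \<odot>\<^bsub>V\<^esub> x) = a \<odot>\<^bsub>W\<^esub> f x)}"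

definition linear_cellular_automaton ::
    "('g, 'm) monoid_scheme \<Rightarrow> ('k, 'l) ring_scheme \<Rightarrow> ('k, 'v, 'n) module_scheme
       \<Rightarrow> (('g \<Rightarrow> 'v) \<Rightarrow> ('g \<Rightarrow> 'v)) \<Rightarrow> bool" where
  "linear_cellular_automaton G K V \<tau> \<longleftrightarrow>
     cellular_automaton G (carrier V) \<tau> \<and>
     \<tau> \<in> linear_maps K (config_module G V) (config_module G V)"

end

theory Submission
  imports Defs
begin

text \<open>
  On each left coset \<open>r\<langle>g\<^sub>0\<rangle>\<close>, which is a copy of the integers because \<open>g\<^sub>0\<close> has infinite order,
  the map is the forward difference operator. Solving \<open>\<tau> x = y\<close> thus amounts to choosing a
  representative of every coset and summing \<open>y\<close> along the coset from there, in both directions.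
  Constant configurations lie in the kernel.
\<close>

text \<open>Once the value at 0 is fixed, the recurrence can be run forwards by adding values of
  \<open>f\<close> and backwards by subtracting them. The solution built here is the one with value
  \<open>\<zero>\<close> at 0.\<close>

lemma (in abelian_group) int_antidifference:
  fixes f :: "int \<Rightarrow> 'a"
  assumes f: "\<And>n. f n \<in> carrier G"
  obtains P where "\<And>n. P n \<in> carrier G" and "\<And>n. P (n + 1) = P n \<oplus> f n"
proof -
  define p where "p = rec_nat \<zero> (\<lambda>k s. s \<oplus> f (int k))"
  \<comment> \<open>\<open>q k\<close> is the value at \<open>- k\<close>. Passing from
    \<open>- k\<close> down to \<open>- (k + 1)\<close> undoes the increment attached to the left
    end of that unit step, hence the argument \<open>- int (Suc k)\<close>.\<close>
  define q where "q = rec_nat \<zero> (\<lambda>k s. s \<ominus> f (- int (Suc k)))"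
  define P where "P n = (if n \<ge> 0 then p (nat n) else q (nat (- n)))" for n :: int
  have p: "p k \<in> carrier G" for k by (induction k) (auto simp: p_def f)
  have q: "q k \<in> carrier G" for k by (induction k) (auto simp: q_def f)
  have step: "P (n + 1) = P n \<oplus> f n" for n
  proof (cases "n \<ge> 0")
    case True
    then have "nat (n + 1) = Suc (nat n)" by simp
    then show ?thesis using True by (simp add: P_def p_def)
  next
    case False
    define k where "k = nat (- n - 1)"
    have n: "n = - int (Suc k)" using False by (simp add: k_def)
    have "P n = q k \<ominus> f n" by (simp add: P_def q_def n nat_add_distrib)
    \<comment> \<open>For \<open>k = 0\<close> the point \<open>n + 1 = 0\<close> already lies in
      the branch of \<open>p\<close>; the two branches agree there because both recursions start at
      \<open>\<zero>\<close>.\<close>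
    moreover have "P (n + 1) = q k" by (cases k) (simp_all add: P_def n p_def q_def nat_add_distrib)
    ultimately show ?thesis by (simp add: minus_eq a_assoc l_neg f q)
  qed
  show thesis
  proof (rule that)
    show "P n \<in> carrier G" for n by (simp add: P_def p q)
  qed (rule step)
qed

lemma (in group) int_pow_inj_of_ord_zero:
  assumes "g \<in> carrier G" "ord g = 0" "g [^] (m::int) = g [^] (n::int)"
  shows "m = n"
  using assms by (simp add: int_pow_eq)

text \<open>Pick a representative \<open>r g\<close> of the left coset of \<open>g\<close> modulo
  the powers of \<open>g0\<close>, and let \<open>e g\<close> be the exponent leading from it to
  \<open>g\<close>. Infinite order makes this exponent unique, so that an arbitrary choice of it
  still increases by exactly 1 under right multiplication by \<open>g0\<close>.\<close>

lemma (in group) cyclic_coset_coordinates: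
  assumes g0: "g0 \<in> carrier G" and ord: "ord g0 = 0"
  obtains r :: "'a \<Rightarrow> 'a" and e :: "'a \<Rightarrow> int"
  where "\<And>g. g \<in> carrier G \<Longrightarrow> r g \<in> carrier G"
    and "\<And>g. g \<in> carrier G \<Longrightarrow> r g \<otimes> g0 [^] e g = g"
    and "\<And>g. g \<in> carrier G \<Longrightarrow> r (g \<otimes> g0) = r g"
    and "\<And>g. g \<in> carrier G \<Longrightarrow> e (g \<otimes> g0) = e g + 1"
proof -
  \<comment> \<open>\<open>R g\<close> is the coset itself. Choosing from this set, rather than for
    each \<open>g\<close> separately, makes \<open>r\<close> constant on cosets: equal sets yield
    the same chosen element.\<close>
  define R where "R g = {h \<in> carrier G. \<exists>n::int. h \<otimes> g0 [^] n = g}" for g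
  define r where "r g = (SOME h. h \<in> R g)" for g
  define e where "e g = (SOME n::int. r g \<otimes> g0 [^] n = g)" for g
  have "g \<in> R g" if "g \<in> carrier G" for g
    using that by (auto simp: R_def intro!: exI[of _ 0])
  then have rR: "r g \<in> R g" if "g \<in> carrier G" for g
    using that unfolding r_def by (metis someI)
  then have r: "r g \<in> carrier G" if "g \<in> carrier G" for g
    using that by (auto simp: R_def)
  have e: "r g \<otimes> g0 [^] e g = g" if "g \<in> carrier G" for g
    using rR[OF that] unfolding R_def e_def by (auto intro: someI_ex)
  have suc: "h \<otimes> g0 [^] (n + 1) = (h \<otimes> g0 [^] n) \<otimes> g0"
    if "h \<in> carrier G" for h and n :: int
    using that g0 by (simp add: int_pow_mult m_assoc)
  \<comment> \<open>Cancelling one factor \<open>g0\<close> on the right gives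
    \<open>R (g \<otimes> g0) \<subseteq> R g\<close>; the reverse inclusion comes from
    \<open>suc\<close>.\<close>
  have "h \<otimes> g0 [^] (n - 1) = g" if "h \<in> carrier G" "g \<in> carrier G" "h \<otimes> g0 [^] n = g \<otimes> g0"
    for h g and n :: int
    using suc[of h "n - 1"] that g0 by simp
  then have "R (g \<otimes> g0) = R g" if "g \<in> carrier G" for g
    using that suc unfolding R_def by blast
  then have rstep: "r (g \<otimes> g0) = r g" if "g \<in> carrier G" for g
    using that by (simp add: r_def)
  have "e (g \<otimes> g0) = e g + 1" if g: "g \<in> carrier G" for g
  proof (rule int_pow_inj_of_ord_zero[OF g0 ord])
    \<comment> \<open>Both sides equal \<open>g \<otimes> g0\<close>, since \<open>g\<close> and
      \<open>g \<otimes> g0\<close> share their representative, which is then cancelled on the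
      left.\<close>
    have "r g \<otimes> g0 [^] e (g \<otimes> g0) = r g \<otimes> g0 [^] (e g + 1)"
      using e[of "g \<otimes> g0"] e[OF g] suc[OF r[OF g]] g g0 by (simp add: rstep)
    then show "g0 [^] e (g \<otimes> g0) = g0 [^] (e g + 1)"
      using r[OF g] g0 by simp
  qed
  with r e rstep show thesis by (rule that)
qed

lemma restrict_in_configs:
  "(\<And>g. g \<in> carrier G \<Longrightarrow> f g \<in> A) \<Longrightarrow> (\<lambda>g\<in>carrier G. f g) \<in> configs G A"
  by (simp add: configs_def)

lemma configs_app: "x \<in> configs G A \<Longrightarrow> g \<in> carrier G \<Longrightarrow> x g \<in> A"
  by (auto simp: configs_def)

lemma configs_eqI:
  assumes "x \<in> configs G A" "y \<in> configs G A" "\<And>g. g \<in> carrier G \<Longrightarrow> x g = y g"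
  shows "x = y"
  using assms unfolding configs_def by (rule PiE_ext)

lemma (in module) smult_minus_distr:
  assumes "a \<in> carrier R" "x \<in> carrier M" "y \<in> carrier M"
  shows "a \<odot>\<^bsub>M\<^esub> (x \<ominus>\<^bsub>M\<^esub> y) = a \<odot>\<^bsub>M\<^esub> x \<ominus>\<^bsub>M\<^esub> a \<odot>\<^bsub>M\<^esub> y"
  using assms by (simp add: M.minus_eq smult_r_distr smult_r_minus)

lemma (in abelian_group) add_minus_add:
  assumes "a \<in> carrier G" "b \<in> carrier G" "c \<in> carrier G" "d \<in> carrier G"
  shows "(a \<oplus> b) \<ominus> (c \<oplus> d) = (a \<ominus> c) \<oplus> (b \<ominus> d)"
  using assms by (simp add: minus_eq minus_add a_ac)

theorem proposition4p1:
  fixes G :: "('g, 'm) monoid_scheme"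
    and K :: "('k, 'l) ring_scheme"
    and V :: "('k, 'v, 'n) module_scheme"
    and \<tau> :: "('g \<Rightarrow> 'v) \<Rightarrow> ('g \<Rightarrow> 'v)"
  assumes "group G"
    and "field K" and "module K V" and "carrier V \<noteq> {\<zero>\<^bsub>V\<^esub>}"
    and "g0 \<in> carrier G" and "group.ord G g0 = 0"
    and "\<tau> = (\<lambda>x\<in>configs G (carrier V). \<lambda>g\<in>carrier G. x (g \<otimes>\<^bsub>G\<^esub> g0) \<ominus>\<^bsub>V\<^esub> x g)"
  shows "linear_cellular_automaton G K V \<tau> \<and>
         \<tau> ` configs G (carrier V) = configs G (carrier V) \<and>
         \<not> inj_on \<tau> (configs G (carrier V))"
proof -
  interpret G: group G by fact
  interpret V: module K V by fact
  let ?C = "configs G (carrier V)"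
  note g0 = \<open>g0 \<in> carrier G\<close>
  have \<tau>: "\<tau> x g = x (g \<otimes>\<^bsub>G\<^esub> g0) \<ominus>\<^bsub>V\<^esub> x g" if "x \<in> ?C" "g \<in> carrier G" for x g
    using that by (simp add: assms(7))
  have \<tau>C: "\<tau> x \<in> ?C" if "x \<in> ?C" for x
    using that g0 by (auto simp: assms(7) intro!: restrict_in_configs intro: configs_app)
  have "cellular_automaton G (carrier V) \<tau>"
    unfolding cellular_automaton_def
  proof (intro conjI exI)
    \<comment> \<open>Shifting \<open>x\<close> by the inverse of \<open>g\<close> and evaluating at
      \<open>h\<close> gives \<open>x\<close> at the product of \<open>g\<close> and
      \<open>h\<close>; the two values needed are those for \<open>h\<close> the identity and
      \<open>h = g0\<close>.\<close>
    let ?M = "{\<one>\<^bsub>G\<^esub>, g0}" and ?\<mu> = "\<lambda>p. p g0 \<ominus>\<^bsub>V\<^esub> p \<one>\<^bsub>G\<^esub>"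
    show "?\<mu> \<in> (?M \<rightarrow>\<^sub>E carrier V) \<rightarrow> carrier V" by auto
    show "\<forall>x\<in>?C. \<forall>g\<in>carrier G. \<tau> x g = ?\<mu> (restrict (shift G (inv\<^bsub>G\<^esub> g) x) ?M)"
      using g0 by (simp add: \<tau> shift_def)
  qed (use \<tau>C g0 in auto)
  moreover have "\<tau> \<in> linear_maps K (config_module G V) (config_module G V)"
  proof -
    \<comment> \<open>Additivity and homogeneity are stated with the pointwise operations of
      \<open>config_module\<close> written out, and checked one group element at a time.\<close>
    have "\<tau> (\<lambda>g\<in>carrier G. x g \<oplus>\<^bsub>V\<^esub> y g) = (\<lambda>g\<in>carrier G. \<tau> x g \<oplus>\<^bsub>V\<^esub> \<tau> y g)"
      if "x \<in> ?C" "y \<in> ?C" for x y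
    proof (rule configs_eqI[OF \<tau>C restrict_in_configs])
      have C: "(\<lambda>g\<in>carrier G. x g \<oplus>\<^bsub>V\<^esub> y g) \<in> ?C"
        using that by (auto intro!: restrict_in_configs intro: configs_app)
      then show "(\<lambda>g\<in>carrier G. x g \<oplus>\<^bsub>V\<^esub> y g) \<in> ?C" .
      show "\<tau> x g \<oplus>\<^bsub>V\<^esub> \<tau> y g \<in> carrier V" if "g \<in> carrier G" for g
        using \<open>x \<in> ?C\<close> \<open>y \<in> ?C\<close> that by (auto intro: configs_app \<tau>C)
      show "\<tau> (\<lambda>g\<in>carrier G. x g \<oplus>\<^bsub>V\<^esub> y g) g = (\<lambda>g\<in>carrier G. \<tau> x g \<oplus>\<^bsub>V\<^esub> \<tau> y g) g"
        if "g \<in> carrier G" for g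
        using \<open>x \<in> ?C\<close> \<open>y \<in> ?C\<close> C that g0 by (simp add: \<tau> V.M.add_minus_add configs_app)
    qed
    moreover have "\<tau> (\<lambda>g\<in>carrier G. a \<odot>\<^bsub>V\<^esub> x g) = (\<lambda>g\<in>carrier G. a \<odot>\<^bsub>V\<^esub> \<tau> x g)"
      if "a \<in> carrier K" "x \<in> ?C" for a x
    proof (rule configs_eqI[OF \<tau>C restrict_in_configs])
      have C: "(\<lambda>g\<in>carrier G. a \<odot>\<^bsub>V\<^esub> x g) \<in> ?C"
        using that by (auto intro!: restrict_in_configs intro: configs_app)
      then show "(\<lambda>g\<in>carrier G. a \<odot>\<^bsub>V\<^esub> x g) \<in> ?C" .
      show "a \<odot>\<^bsub>V\<^esub> \<tau> x g \<in> carrier V" if "g \<in> carrier G" for g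
        using \<open>a \<in> carrier K\<close> \<open>x \<in> ?C\<close> that by (auto intro: configs_app \<tau>C)
      show "\<tau> (\<lambda>g\<in>carrier G. a \<odot>\<^bsub>V\<^esub> x g) g = (\<lambda>g\<in>carrier G. a \<odot>\<^bsub>V\<^esub> \<tau> x g) g"
        if "g \<in> carrier G" for g
        using \<open>a \<in> carrier K\<close> \<open>x \<in> ?C\<close> C that g0
        by (simp add: \<tau> V.smult_minus_distr configs_app)
    qed
    ultimately show ?thesis
      using \<tau>C by (simp add: linear_maps_def config_module_def Pi_iff)
  qed
  moreover have "\<exists>x\<in>?C. \<tau> x = y" if y: "y \<in> ?C" for y
  proof -
    obtain r and e :: "'g \<Rightarrow> int" where
      r: "\<And>g. g \<in> carrier G \<Longrightarrow> r g \<in> carrier G"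
      and re: "\<And>g. g \<in> carrier G \<Longrightarrow> r g \<otimes>\<^bsub>G\<^esub> g0 [^]\<^bsub>G\<^esub> e g = g"
      and rstep: "\<And>g. g \<in> carrier G \<Longrightarrow> r (g \<otimes>\<^bsub>G\<^esub> g0) = r g"
      and estep: "\<And>g. g \<in> carrier G \<Longrightarrow> e (g \<otimes>\<^bsub>G\<^esub> g0) = e g + 1"
      using G.cyclic_coset_coordinates[OF g0 assms(6)] by blast
    \<comment> \<open>The sequence to be summed is \<open>y\<close> read along the coset of
      \<open>h\<close>, with \<open>h\<close> at position 0.\<close>
    have "\<exists>P. \<forall>n::int. P n \<in> carrier V \<and> P (n + 1) = P n \<oplus>\<^bsub>V\<^esub> y (h \<otimes>\<^bsub>G\<^esub> g0 [^]\<^bsub>G\<^esub> n)"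
      if "h \<in> carrier G" for h
    proof -
      have "y (h \<otimes>\<^bsub>G\<^esub> g0 [^]\<^bsub>G\<^esub> n) \<in> carrier V" for n :: int
        using that g0 by (auto intro: configs_app[OF y])
      from V.M.int_antidifference[of "\<lambda>n. y (h \<otimes>\<^bsub>G\<^esub> g0 [^]\<^bsub>G\<^esub> n)", OF this]
      show ?thesis by metis
    qed
    then obtain P where
      P: "\<And>h n. h \<in> carrier G \<Longrightarrow> P h n \<in> carrier V"
      and Pstep: "\<And>h n. h \<in> carrier G \<Longrightarrow>
        P h (n + 1) = P h n \<oplus>\<^bsub>V\<^esub> y (h \<otimes>\<^bsub>G\<^esub> g0 [^]\<^bsub>G\<^esub> (n::int))"
      by metis
    \<comment> \<open>Each coset uses the antidifference based at its own representative, evaluated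
      at the position of \<open>g\<close> in the coset.\<close>
    define x where "x = (\<lambda>g\<in>carrier G. P (r g) (e g))"
    have x: "x \<in> ?C" unfolding x_def by (intro restrict_in_configs P r)
    moreover have "\<tau> x = y"
    proof (rule configs_eqI[OF \<tau>C[OF x] y])
      fix g assume g: "g \<in> carrier G"
      \<comment> \<open>Right multiplication by \<open>g0\<close> keeps \<open>r g\<close> and moves
        the position from \<open>e g\<close> to \<open>e g + 1\<close>, so \<open>Pstep\<close> adds
        the value of \<open>y\<close> at the point with coordinates \<open>r g\<close> and
        \<open>e g\<close>, which is \<open>g\<close>.\<close>
      have "\<tau> x g = (P (r g) (e g) \<oplus>\<^bsub>V\<^esub> y g) \<ominus>\<^bsub>V\<^esub> P (r g) (e g)"
        using g g0 by (simp add: \<tau>[OF x g]) (simp add: x_def rstep estep Pstep r re)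
      also have "\<dots> = y g"
        using P[OF r[OF g]] configs_app[OF y g]
        by (simp add: V.M.minus_eq V.M.a_ac V.M.r_neg)
      finally show "\<tau> x g = y g" .
    qed
    ultimately show ?thesis by blast
  qed
  then have "\<tau> ` ?C = ?C" using \<tau>C by blast
  moreover have "\<not> inj_on \<tau> ?C"
  proof
    assume inj: "inj_on \<tau> ?C"
    obtain v where v: "v \<in> carrier V" "v \<noteq> \<zero>\<^bsub>V\<^esub>" using assms(4) by blast
    define c :: "'v \<Rightarrow> 'g \<Rightarrow> 'v" where "c u = (\<lambda>g\<in>carrier G. u)" for u
    have c: "c u \<in> ?C" if "u \<in> carrier V" for u
      using that unfolding c_def by (rule restrict_in_configs)
    have "\<tau> (c v) = \<tau> (c \<zero>\<^bsub>V\<^esub>)"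
    proof (rule configs_eqI[OF \<tau>C \<tau>C])
      show "\<tau> (c v) g = \<tau> (c \<zero>\<^bsub>V\<^esub>) g" if "g \<in> carrier G" for g
        using that v g0 by (simp add: \<tau> c) (simp add: c_def V.M.minus_eq V.M.r_neg)
    qed (auto intro: c v)
    then have "c v = c \<zero>\<^bsub>V\<^esub>" using inj c v by (auto dest: inj_onD)
    \<comment> \<open>Extensional functions are told apart only on the carrier, so the two constants
      are compared at a point known to lie in it.\<close>
    then have "c v \<one>\<^bsub>G\<^esub> = c \<zero>\<^bsub>V\<^esub> \<one>\<^bsub>G\<^esub>" by simp
    then show False using v by (simp add: c_def)
  qed
  ultimately show ?thesis by (simp add: linear_cellular_automaton_def)
qed

end
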